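(* Let $R$ be a commutative ring and let $G$ be an edge-labeled graph over $R$. Then the ring of splines $R_G$ is isomorphic, as a ring, to the ring of limit splines of $G$, that is, to the limit in the category of commutative rings of the spline diagram $\mathfrak{G}$ associated to $G$.
   Context: An edge-labeled graph $G$ over $R$ is a finite graph $(V,E)$ with a map $\alpha$ from $E$ to the set of ideals of $R$; write $e_{uv}$ for an edge joining $u$ and $v$ and $I_{uv}=\alpha(e_{uv})$. A spline is a function $s:V\to R$ with $s(u)-s(v)\in\alpha(e_{uv})$ for every edge $e_{uv}\in E$. The set $R_G$ of all splines is a ring under pointwise operations. The spline diagram $\mathfrak{G}$ associated to $G$ is the diagram in the category of commutative rings having one object $R_u=R$ for each vertex $u\in V$, one object $R/I_{uv}$ for each edge $e_{uv}\in E$, and, for each edge $e_{uv}$, the quotient morphisms $R_u\to R/I_{uv}\leftarrow R_v$. Its limit is called the ring of limit splines. *)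

theory Defs
  imports "HOL-Algebra.QuotRing"
begin

text \<open>
  Edges are abstract elements with a set of endpoints, so multiple edges and loops are admitted; a
  simple graph is the case where \<open>E\<close> is a set of two-element subsets of \<open>V\<close> and \<open>ends\<close> is the identity.
\<close>

locale edge_labeled_graph = cring R for R :: "'a ring" (structure) +
  fixes V :: "'v set" and E :: "'e set" and ends :: "'e \<Rightarrow> 'v set" and \<alpha> :: "'e \<Rightarrow> 'a set"
  assumes finite_vertices: "finite V"
    and finite_edges: "finite E"
    and ends: "e \<in> E \<Longrightarrow> \<exists>u\<in>V. \<exists>v\<in>V. ends e = {u, v}"
    and label_ideal: "e \<in> E \<Longrightarrow> ideal (\<alpha> e) R"

text \<open>Functions on \<open>V\<close> are extensional, so that equality of splines is equality on \<open>V\<close>.\<close>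

definition splines ::
    "'a ring \<Rightarrow> 'v set \<Rightarrow> 'e set \<Rightarrow> ('e \<Rightarrow> 'v set) \<Rightarrow> ('e \<Rightarrow> 'a set) \<Rightarrow> ('v \<Rightarrow> 'a) set" where
  "splines R V E ends \<alpha> =
    {s \<in> V \<rightarrow>\<^sub>E carrier R. \<forall>e\<in>E. \<forall>u v. ends e = {u, v} \<longrightarrow> s u \<ominus>\<^bsub>R\<^esub> s v \<in> \<alpha> e}"

definition spline_ring ::
    "'a ring \<Rightarrow> 'v set \<Rightarrow> 'e set \<Rightarrow> ('e \<Rightarrow> 'v set) \<Rightarrow> ('e \<Rightarrow> 'a set) \<Rightarrow> ('v \<Rightarrow> 'a) ring" where
  "spline_ring R V E ends \<alpha> =
    \<lparr>carrier = splines R V E ends \<alpha>,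
     mult = (\<lambda>s t. \<lambda>v\<in>V. s v \<otimes>\<^bsub>R\<^esub> t v),
     one = (\<lambda>v\<in>V. \<one>\<^bsub>R\<^esub>),
     zero = (\<lambda>v\<in>V. \<zero>\<^bsub>R\<^esub>),
     add = (\<lambda>s t. \<lambda>v\<in>V. s v \<oplus>\<^bsub>R\<^esub> t v)\<rparr>"

text \<open>
  The library realises \<open>R\<close> on a type \<open>'a\<close> and its quotients on \<open>'a set\<close>, hence a diagram involving both
  needs two families of objects. We treat diagrams in which every arrow runs from an object of the
  first family to an object of the second; nothing more is assumed about their shape.
\<close>

record ('j, 'k, 'm, 'b, 'c) ring_diagram =
  src_ix :: "'j set"
  tgt_ix :: "'k set"
  src_ring :: "'j \<Rightarrow> 'b ring"
  tgt_ring :: "'k \<Rightarrow> 'c ring"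
  arrs :: "'m set"
  arr_src :: "'m \<Rightarrow> 'j"
  arr_tgt :: "'m \<Rightarrow> 'k"
  arr_map :: "'m \<Rightarrow> 'b \<Rightarrow> 'c"

definition is_cring_diagram :: "('j, 'k, 'm, 'b, 'c) ring_diagram \<Rightarrow> bool" where
  "is_cring_diagram D \<longleftrightarrow>
    (\<forall>j\<in>src_ix D. cring (src_ring D j)) \<and>
    (\<forall>k\<in>tgt_ix D. cring (tgt_ring D k)) \<and>
    (\<forall>a\<in>arrs D. arr_src D a \<in> src_ix D \<and> arr_tgt D a \<in> tgt_ix D \<and>
       arr_map D a \<in> ring_hom (src_ring D (arr_src D a)) (tgt_ring D (arr_tgt D a)))"

definition is_cone ::
    "('j, 'k, 'm, 'b, 'c) ring_diagram \<Rightarrow> 't ring \<Rightarrow> ('j \<Rightarrow> 't \<Rightarrow> 'b) \<Rightarrow> ('k \<Rightarrow> 't \<Rightarrow> 'c) \<Rightarrow> bool" where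
  "is_cone D T f g \<longleftrightarrow>
    cring T \<and>
    (\<forall>j\<in>src_ix D. f j \<in> ring_hom T (src_ring D j)) \<and>
    (\<forall>k\<in>tgt_ix D. g k \<in> ring_hom T (tgt_ring D k)) \<and>
    (\<forall>a\<in>arrs D. \<forall>x\<in>carrier T. arr_map D a (f (arr_src D a) x) = g (arr_tgt D a) x)"

text \<open>
  A limit is a terminal cone. HOL cannot quantify over all types inside a formula, so the type \<open>'t\<close>
  carrying the test cones is a parameter. Mediating homomorphisms are taken extensional because a
  ring homomorphism is only determined on the carrier.
\<close>

definition is_limit ::
    "'t itself \<Rightarrow> ('j, 'k, 'm, 'b, 'c) ring_diagram \<Rightarrow>
     'l ring \<Rightarrow> ('j \<Rightarrow> 'l \<Rightarrow> 'b) \<Rightarrow> ('k \<Rightarrow> 'l \<Rightarrow> 'c) \<Rightarrow> bool" where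
  "is_limit _ D L p q \<longleftrightarrow>
    is_cring_diagram D \<and> is_cone D L p q \<and>
    (\<forall>(T :: 't ring) f g. is_cone D T f g \<longrightarrow>
      (\<exists>!h. h \<in> ring_hom T L \<and> h \<in> extensional (carrier T) \<and>
        (\<forall>j\<in>src_ix D. \<forall>x\<in>carrier T. p j (h x) = f j x) \<and>
        (\<forall>k\<in>tgt_ix D. \<forall>x\<in>carrier T. q k (h x) = g k x)))"

text \<open>
  The arrows are the incidences \<open>(v, e)\<close> with \<open>v\<close> an endpoint of \<open>e\<close>, mapped to the quotient morphism
  \<open>R\<^sub>v \<rightarrow> R / \<alpha> e\<close>. (For a loop the two quotient morphisms coincide and are listed once.)
\<close>

definition spline_diagram ::
    "'a ring \<Rightarrow> 'v set \<Rightarrow> 'e set \<Rightarrow> ('e \<Rightarrow> 'v set) \<Rightarrow> ('e \<Rightarrow> 'a set) \<Rightarrow>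
     ('v, 'e, 'v \<times> 'e, 'a, 'a set) ring_diagram" where
  "spline_diagram R V E ends \<alpha> =
    \<lparr>src_ix = V,
     tgt_ix = E,
     src_ring = (\<lambda>v. R),
     tgt_ring = (\<lambda>e. R Quot \<alpha> e),
     arrs = {(v, e). e \<in> E \<and> v \<in> ends e},
     arr_src = fst,
     arr_tgt = snd,
     arr_map = (\<lambda>(v, e) x. \<alpha> e +>\<^bsub>R\<^esub> x)\<rparr>"

end

theory Submission
  imports Defs
begin

text \<open>
  Two elements of \<open>R\<close> differ by an element of an ideal exactly when their cosets agree. Hence a spline
  is the same thing as a family of ring elements over \<open>V\<close> whose images in \<open>R / \<alpha> e\<close> agree for all
  endpoints of \<open>e\<close>, and a cone over the spline diagram assembles pointwise into a map into the splines.
\<close>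

section \<open>Limits of ring diagrams\<close>

lemma is_limit_hom_comp_eq:
  fixes D :: "('j, 'k, 'm, 'b, 'c) ring_diagram" and L :: "'l ring" and S :: "'s ring"
  assumes lim: "is_limit TYPE('l) D L p q" and S: "is_limit TYPE('s) D S p' q'"
    and h: "h \<in> ring_hom L S"
      "\<And>j x. j \<in> src_ix D \<Longrightarrow> x \<in> carrier L \<Longrightarrow> p' j (h x) = p j x"
      "\<And>k x. k \<in> tgt_ix D \<Longrightarrow> x \<in> carrier L \<Longrightarrow> q' k (h x) = q k x"
    and h': "h' \<in> ring_hom S L"
      "\<And>j x. j \<in> src_ix D \<Longrightarrow> x \<in> carrier S \<Longrightarrow> p j (h' x) = p' j x"
      "\<And>k x. k \<in> tgt_ix D \<Longrightarrow> x \<in> carrier S \<Longrightarrow> q k (h' x) = q' k x"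
    and x: "x \<in> carrier L"
  shows "h' (h x) = x"
proof -
  define P where "P r \<longleftrightarrow> r \<in> ring_hom L L \<and> r \<in> extensional (carrier L) \<and>
        (\<forall>j\<in>src_ix D. \<forall>x\<in>carrier L. p j (r x) = p j x) \<and>
        (\<forall>k\<in>tgt_ix D. \<forall>x\<in>carrier L. q k (r x) = q k x)" for r
  have "is_cone D L p q" and "\<exists>!r. P r"
    using lim unfolding is_limit_def P_def by blast+
  have "cring L" using \<open>is_cone D L p q\<close> by (simp add: is_cone_def)
  interpret L: cring L by fact
  have hc: "h y \<in> carrier S" if "y \<in> carrier L" for y
    using h(1) that by (rule ring_hom_closed)
  have "h' \<circ> h \<in> ring_hom L L"
    using ring_hom_trans[OF h(1) h'(1)] .
  then have "restrict (h' \<circ> h) (carrier L) \<in> ring_hom L L"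
    unfolding ring_hom_def by (auto simp: restrict_def)
  then have "P (restrict (h' \<circ> h) (carrier L))"
    unfolding P_def by (simp add: h(2,3) h'(2,3) hc)
  moreover have "P (restrict id (carrier L))"
    unfolding P_def by (auto intro!: ring_hom_memI)
  ultimately have "restrict (h' \<circ> h) (carrier L) = restrict id (carrier L)"
    using \<open>\<exists>!r. P r\<close> by blast
  then have "restrict (h' \<circ> h) (carrier L) x = restrict id (carrier L) x"
    by simp
  then show ?thesis using x by simp
qed

lemma is_limit_unique:
  fixes D :: "('j, 'k, 'm, 'b, 'c) ring_diagram" and L :: "'l ring" and S :: "'s ring"
  assumes Ll: "is_limit TYPE('l) D L p q" and Ls: "is_limit TYPE('s) D L p q"
    and Sl: "is_limit TYPE('l) D S p' q'" and Ss: "is_limit TYPE('s) D S p' q'"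
  shows "S \<simeq> L"
proof -
  have "is_cone D L p q" "is_cone D S p' q'"
    using Ll Ss unfolding is_limit_def by blast+
  obtain h where h: "h \<in> ring_hom S L"
      "\<And>j x. j \<in> src_ix D \<Longrightarrow> x \<in> carrier S \<Longrightarrow> p j (h x) = p' j x"
      "\<And>k x. k \<in> tgt_ix D \<Longrightarrow> x \<in> carrier S \<Longrightarrow> q k (h x) = q' k x"
    using Ls \<open>is_cone D S p' q'\<close> unfolding is_limit_def by metis
  obtain h' where h': "h' \<in> ring_hom L S"
      "\<And>j x. j \<in> src_ix D \<Longrightarrow> x \<in> carrier L \<Longrightarrow> p' j (h' x) = p j x"
      "\<And>k x. k \<in> tgt_ix D \<Longrightarrow> x \<in> carrier L \<Longrightarrow> q' k (h' x) = q k x"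
    using Sl \<open>is_cone D L p q\<close> unfolding is_limit_def by metis
  have "bij_betw h (carrier S) (carrier L)"
  proof (rule bij_betwI)
    show "h' (h x) = x" if "x \<in> carrier S" for x
      by (rule is_limit_hom_comp_eq[OF Ss Ll h(1) _ _ h'(1) _ _ that]) (use h h' in blast)+
    show "h (h' x) = x" if "x \<in> carrier L" for x
      by (rule is_limit_hom_comp_eq[OF Ll Ss h'(1) _ _ h(1) _ _ that]) (use h h' in blast)+
  qed (use h(1) h'(1) in \<open>auto dest: ring_hom_closed\<close>)
  then show ?thesis
    using h(1) unfolding is_ring_iso_def ring_iso_def by blast
qed

section \<open>The ring of splines\<close>

context edge_labeled_graph
begin

lemma coset_eq_iff:
  assumes "e \<in> E" "x \<in> carrier R" "y \<in> carrier R"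
  shows "\<alpha> e +> x = \<alpha> e +> y \<longleftrightarrow> x \<ominus> y \<in> \<alpha> e"
proof -
  interpret ideal "\<alpha> e" R using label_ideal[OF assms(1)] .
  show ?thesis using quotient_eq_iff_same_a_r_cos[of "\<alpha> e" x y] is_ideal assms by auto
qed

lemma coset_hom: "e \<in> E \<Longrightarrow> (+>) (\<alpha> e) \<in> ring_hom R (R Quot \<alpha> e)"
  using ideal.rcos_ring_hom[OF label_ideal] .

lemma endpoint_in_V: "e \<in> E \<Longrightarrow> v \<in> ends e \<Longrightarrow> v \<in> V"
  using ends[of e] by auto

lemma splines_iff:
  "s \<in> splines R V E ends \<alpha> \<longleftrightarrow>
    s \<in> V \<rightarrow>\<^sub>E carrier R \<and> (\<forall>e\<in>E. \<forall>u\<in>ends e. \<forall>v\<in>ends e. \<alpha> e +> s u = \<alpha> e +> s v)"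
proof (cases "s \<in> V \<rightarrow>\<^sub>E carrier R")
  case True
  have "(\<forall>u v. ends e = {u, v} \<longrightarrow> s u \<ominus> s v \<in> \<alpha> e) \<longleftrightarrow>
      (\<forall>u\<in>ends e. \<forall>v\<in>ends e. \<alpha> e +> s u = \<alpha> e +> s v)" if e: "e \<in> E" for e
  proof -
    have "s v \<in> carrier R" if "v \<in> ends e" for v
      using True endpoint_in_V[OF e that] by auto
    then have eq: "\<alpha> e +> s u = \<alpha> e +> s v \<longleftrightarrow> s u \<ominus> s v \<in> \<alpha> e"
      if "u \<in> ends e" "v \<in> ends e" for u v
      using coset_eq_iff[OF e] that by simp
    obtain a b where ab: "ends e = {a, b}"
      using ends[OF e] by blast
    show ?thesis
    proof
      assume *: "\<forall>u v. ends e = {u, v} \<longrightarrow> s u \<ominus> s v \<in> \<alpha> e"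
      then have "s a \<ominus> s b \<in> \<alpha> e" using ab by blast
      then have "\<alpha> e +> s a = \<alpha> e +> s b" using eq ab by simp
      then show "\<forall>u\<in>ends e. \<forall>v\<in>ends e. \<alpha> e +> s u = \<alpha> e +> s v"
        unfolding ab by simp
    next
      assume *: "\<forall>u\<in>ends e. \<forall>v\<in>ends e. \<alpha> e +> s u = \<alpha> e +> s v"
      show "\<forall>u v. ends e = {u, v} \<longrightarrow> s u \<ominus> s v \<in> \<alpha> e"
      proof (intro allI impI)
        fix u v assume "ends e = {u, v}"
        then have "u \<in> ends e" "v \<in> ends e" by simp_all
        then show "s u \<ominus> s v \<in> \<alpha> e" using * eq by blast
      qed
    qed
  qed
  with True show ?thesis unfolding splines_def by simp
qed (simp add: splines_def)

abbreviation RG :: "('v \<Rightarrow> 'a) ring" where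
  "RG \<equiv> spline_ring R V E ends \<alpha>"

lemma spline_closed: "s \<in> carrier RG \<Longrightarrow> v \<in> V \<Longrightarrow> s v \<in> carrier R"
  by (auto simp: spline_ring_def splines_def)

lemma spline_extensional: "s \<in> carrier RG \<Longrightarrow> s \<in> extensional V"
  by (simp add: spline_ring_def splines_def PiE_iff)

lemma spline_eqI:
  assumes "s \<in> carrier RG" "t \<in> carrier RG" "\<And>v. v \<in> V \<Longrightarrow> s v = t v"
  shows "s = t"
  using extensionalityI[OF spline_extensional[OF assms(1)] spline_extensional[OF assms(2)] assms(3)] .

lemma spline_coset_eq:
  "s \<in> carrier RG \<Longrightarrow> e \<in> E \<Longrightarrow> u \<in> ends e \<Longrightarrow> v \<in> ends e \<Longrightarrow> \<alpha> e +> s u = \<alpha> e +> s v"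
  unfolding spline_ring_def partial_object.simps splines_iff by blast

lemma splineI:
  assumes "\<And>v. v \<in> V \<Longrightarrow> c v \<in> carrier R"
    and "\<And>e u v. e \<in> E \<Longrightarrow> u \<in> ends e \<Longrightarrow> v \<in> ends e \<Longrightarrow> \<alpha> e +> c u = \<alpha> e +> c v"
  shows "(\<lambda>v\<in>V. c v) \<in> carrier RG"
proof -
  have "\<alpha> e +> (\<lambda>v\<in>V. c v) u = \<alpha> e +> (\<lambda>v\<in>V. c v) v"
    if "e \<in> E" "u \<in> ends e" "v \<in> ends e" for e u v
    using assms(2)[OF that] that by (simp add: endpoint_in_V)
  moreover have "(\<lambda>v\<in>V. c v) \<in> V \<rightarrow>\<^sub>E carrier R"
    using assms(1) by (rule restrict_PiE_iff[THEN iffD2, rule_format])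
  ultimately show ?thesis
    unfolding spline_ring_def partial_object.simps splines_iff by blast
qed

lemma spline_ring_ops:
  "v \<in> V \<Longrightarrow> (s \<otimes>\<^bsub>RG\<^esub> t) v = s v \<otimes> t v"
  "v \<in> V \<Longrightarrow> (s \<oplus>\<^bsub>RG\<^esub> t) v = s v \<oplus> t v"
  "v \<in> V \<Longrightarrow> \<one>\<^bsub>RG\<^esub> v = \<one>"
  "v \<in> V \<Longrightarrow> \<zero>\<^bsub>RG\<^esub> v = \<zero>"
  by (simp_all add: spline_ring_def)

lemma spline_ring_closed:
  shows "s \<in> carrier RG \<Longrightarrow> t \<in> carrier RG \<Longrightarrow> s \<otimes>\<^bsub>RG\<^esub> t \<in> carrier RG"
    and "s \<in> carrier RG \<Longrightarrow> t \<in> carrier RG \<Longrightarrow> s \<oplus>\<^bsub>RG\<^esub> t \<in> carrier RG"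
    and "\<one>\<^bsub>RG\<^esub> \<in> carrier RG"
    and "\<zero>\<^bsub>RG\<^esub> \<in> carrier RG"
proof -
  show "\<one>\<^bsub>RG\<^esub> \<in> carrier RG" "\<zero>\<^bsub>RG\<^esub> \<in> carrier RG"
    using splineI[of "\<lambda>_. \<one>"] splineI[of "\<lambda>_. \<zero>"] by (simp_all add: spline_ring_def)
  fix s t
  assume s: "s \<in> carrier RG" and t: "t \<in> carrier RG"
  have "(\<lambda>v\<in>V. s v \<otimes> t v) \<in> carrier RG"
  proof (rule splineI)
    fix e u v assume *: "e \<in> E" "u \<in> ends e" "v \<in> ends e"
    have V: "u \<in> V" "v \<in> V" using * by (blast intro: endpoint_in_V)+
    show "\<alpha> e +> (s u \<otimes> t u) = \<alpha> e +> (s v \<otimes> t v)"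
      using spline_coset_eq[OF s *] spline_coset_eq[OF t *]
      by (simp add: ring_hom_mult[OF coset_hom[OF *(1)]] spline_closed[OF s] spline_closed[OF t] V)
  qed (simp add: spline_closed s t)
  then show "s \<otimes>\<^bsub>RG\<^esub> t \<in> carrier RG" by (simp add: spline_ring_def)
  have "(\<lambda>v\<in>V. s v \<oplus> t v) \<in> carrier RG"
  proof (rule splineI)
    fix e u v assume *: "e \<in> E" "u \<in> ends e" "v \<in> ends e"
    have V: "u \<in> V" "v \<in> V" using * by (blast intro: endpoint_in_V)+
    show "\<alpha> e +> (s u \<oplus> t u) = \<alpha> e +> (s v \<oplus> t v)"
      using spline_coset_eq[OF s *] spline_coset_eq[OF t *]
      by (simp add: ring_hom_add[OF coset_hom[OF *(1)]] spline_closed[OF s] spline_closed[OF t] V)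
  qed (simp add: spline_closed s t)
  then show "s \<oplus>\<^bsub>RG\<^esub> t \<in> carrier RG" by (simp add: spline_ring_def)
qed

lemma spline_uminus_closed:
  assumes s: "s \<in> carrier RG"
  shows "(\<lambda>v\<in>V. \<ominus> s v) \<in> carrier RG"
proof (rule splineI)
  fix e u v assume *: "e \<in> E" "u \<in> ends e" "v \<in> ends e"
  interpret coset: ring_hom_ring R "R Quot \<alpha> e" "(+>) (\<alpha> e)"
    using ideal.rcos_ring_hom_ring[OF label_ideal] * by blast
  show "\<alpha> e +> (\<ominus> s u) = \<alpha> e +> (\<ominus> s v)"
    using spline_coset_eq[OF s *] * by (simp add: spline_closed[OF s] endpoint_in_V)
qed (simp add: spline_closed s)

lemma cring_spline_ring: "cring RG"
proof (rule cringI)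
  show "abelian_group RG"
  proof (rule abelian_groupI)
    fix s assume s: "s \<in> carrier RG"
    have "(\<lambda>v\<in>V. \<ominus> s v) \<oplus>\<^bsub>RG\<^esub> s = \<zero>\<^bsub>RG\<^esub>"
      by (rule spline_eqI)
        (simp_all add: spline_ring_ops spline_ring_closed spline_uminus_closed s
          spline_closed[OF s] l_neg)
    then show "\<exists>t\<in>carrier RG. t \<oplus>\<^bsub>RG\<^esub> s = \<zero>\<^bsub>RG\<^esub>"
      using spline_uminus_closed[OF s] by blast
  qed (auto intro!: spline_eqI simp: spline_ring_ops spline_ring_closed spline_closed a_ac)
  show "comm_monoid RG"
    by (rule comm_monoidI)
      (auto intro!: spline_eqI simp: spline_ring_ops spline_ring_closed spline_closed m_ac)
qed (auto intro!: spline_eqI simp: spline_ring_ops spline_ring_closed spline_closed l_distr)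

section \<open>The limit of the spline diagram\<close>

lemma is_cring_diagram_spline_diagram: "is_cring_diagram (spline_diagram R V E ends \<alpha>)"
  using is_cring ideal.quotient_is_cring[OF label_ideal is_cring]
  by (auto simp: is_cring_diagram_def spline_diagram_def endpoint_in_V coset_hom)

lemma spline_eval_hom: "v \<in> V \<Longrightarrow> (\<lambda>s. s v) \<in> ring_hom RG R"
  by (rule ring_hom_memI) (simp_all add: spline_ring_ops spline_closed)

definition spline_coset :: "'e \<Rightarrow> ('v \<Rightarrow> 'a) \<Rightarrow> 'a set" where
  "spline_coset e s = \<alpha> e +> s (SOME v. v \<in> ends e)"

lemma some_endpoint: "e \<in> E \<Longrightarrow> (SOME v. v \<in> ends e) \<in> ends e"
  using ends[of e] by (metis insertI1 someI)

lemma spline_coset_eq_endpoint: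
  "s \<in> carrier RG \<Longrightarrow> e \<in> E \<Longrightarrow> v \<in> ends e \<Longrightarrow> spline_coset e s = \<alpha> e +> s v"
  unfolding spline_coset_def using spline_coset_eq some_endpoint by blast

lemma is_cone_spline_ring:
  "is_cone (spline_diagram R V E ends \<alpha>) RG (\<lambda>v s. s v) spline_coset"
proof -
  have "spline_coset e \<in> ring_hom RG (R Quot \<alpha> e)" if "e \<in> E" for e
    using ring_hom_trans[OF spline_eval_hom[OF endpoint_in_V[OF that some_endpoint[OF that]]]
        coset_hom[OF that]]
    unfolding spline_coset_def[abs_def] comp_def .
  then show ?thesis
    by (auto simp: is_cone_def spline_diagram_def cring_spline_ring spline_eval_hom
        spline_coset_eq_endpoint)
qed

lemma is_limit_spline_ring:
  "is_limit TYPE('t) (spline_diagram R V E ends \<alpha>) RG (\<lambda>v s. s v) spline_coset"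
  unfolding is_limit_def
proof (intro conjI allI impI is_cring_diagram_spline_diagram is_cone_spline_ring)
  fix T :: "'t ring" and f g
  assume "is_cone (spline_diagram R V E ends \<alpha>) T f g"
  then have T: "cring T"
    and f: "\<And>v. v \<in> V \<Longrightarrow> f v \<in> ring_hom T R"
    and fg: "\<And>e v x. e \<in> E \<Longrightarrow> v \<in> ends e \<Longrightarrow> x \<in> carrier T \<Longrightarrow> \<alpha> e +> f v x = g e x"
    by (auto simp: is_cone_def spline_diagram_def)
  interpret T: cring T by fact
  define h where "h = (\<lambda>x\<in>carrier T. \<lambda>v\<in>V. f v x)"
  have h_closed: "h x \<in> carrier RG" if "x \<in> carrier T" for x
    unfolding h_def restrict_apply'[OF that]
    by (rule splineI) (simp_all add: fg that ring_hom_closed[OF f])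
  have h_apply: "h x v = f v x" if "x \<in> carrier T" "v \<in> V" for x v
    using that by (simp add: h_def)
  show "\<exists>!h. h \<in> ring_hom T RG \<and> h \<in> extensional (carrier T) \<and>
        (\<forall>j\<in>src_ix (spline_diagram R V E ends \<alpha>). \<forall>x\<in>carrier T. h x j = f j x) \<and>
        (\<forall>k\<in>tgt_ix (spline_diagram R V E ends \<alpha>). \<forall>x\<in>carrier T. spline_coset k (h x) = g k x)"
  proof (rule ex1I[of _ h], intro conjI ballI)
    show "h \<in> ring_hom T RG"
      by (rule ring_hom_memI; (rule spline_eqI)?)
        (simp_all add: h_closed h_apply spline_ring_closed spline_ring_ops ring_hom_mult[OF f]
          ring_hom_add[OF f] ring_hom_one[OF f])
    show "h \<in> extensional (carrier T)" by (simp add: h_def)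
    show "h x v = f v x" if "v \<in> src_ix (spline_diagram R V E ends \<alpha>)" "x \<in> carrier T" for v x
      using that by (simp add: h_apply spline_diagram_def)
    show "spline_coset e (h x) = g e x"
      if "e \<in> tgt_ix (spline_diagram R V E ends \<alpha>)" "x \<in> carrier T" for e x
    proof -
      have e: "e \<in> E" using that by (simp add: spline_diagram_def)
      show ?thesis
        using spline_coset_eq_endpoint[OF h_closed[OF that(2)] e some_endpoint[OF e]]
          h_apply[OF that(2) endpoint_in_V[OF e some_endpoint[OF e]]]
          fg[OF e some_endpoint[OF e] that(2)]
        by simp
    qed
  next
    fix h'
    assume h': "h' \<in> ring_hom T RG \<and> h' \<in> extensional (carrier T) \<and>
        (\<forall>j\<in>src_ix (spline_diagram R V E ends \<alpha>). \<forall>x\<in>carrier T. h' x j = f j x) \<and>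
        (\<forall>k\<in>tgt_ix (spline_diagram R V E ends \<alpha>). \<forall>x\<in>carrier T. spline_coset k (h' x) = g k x)"
    show "h' = h"
    proof (rule extensionalityI[of _ "carrier T"])
      fix x assume x: "x \<in> carrier T"
      show "h' x = h x"
        using h' x
        by (intro spline_eqI) (auto simp: h_closed h_apply spline_diagram_def dest: ring_hom_closed)
    qed (use h' in \<open>simp_all add: h_def\<close>)
  qed
qed

end

theorem theorem1:
  fixes R :: "'a ring" and V :: "'v set" and E :: "'e set"
    and ends :: "'e \<Rightarrow> 'v set" and \<alpha> :: "'e \<Rightarrow> 'a set"
  assumes "edge_labeled_graph R V E ends \<alpha>"
  shows "(\<exists>q. is_limit TYPE('t) (spline_diagram R V E ends \<alpha>)
            (spline_ring R V E ends \<alpha>) (\<lambda>v s. s v) q) \<and>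
         (\<forall>(L :: 'l ring) p q.
            is_limit TYPE('l) (spline_diagram R V E ends \<alpha>) L p q \<and>
            is_limit TYPE('v \<Rightarrow> 'a) (spline_diagram R V E ends \<alpha>) L p q \<longrightarrow>
            spline_ring R V E ends \<alpha> \<simeq> L)"
proof -
  note limit = edge_labeled_graph.is_limit_spline_ring[OF assms]
  show ?thesis
    using limit is_limit_unique[OF _ _ limit limit] by blast
qed

end
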